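(* Let $\mathfrak g$ be a nilpotent Lie algebra with a pseudo-Riemannian metric $g$, let $D$ be a derivation of $\mathfrak g$ and let $\tau=\pm1$. Then $\tilde{\mathfrak g}=\mathfrak g\rtimes_D\mathrm{Span}\{e_0\}$ has a Sasaki structure $(\phi,\xi,\eta,\tilde g)$ such that $$\tilde g=g+\tau e^0\otimes e^0$$ if and only if for some $\xi\in\mathfrak g$, $b=D^a(\xi)$, $\eta=\xi^\flat$, writing $$\alpha_x(u,w)=d\eta((\mathrm{ad}\,u)^*(x),w)-d\eta((\mathrm{ad}\,w)^*(x),u),$$ the following hold for all $x,y\in\mathfrak g$: \begin{gather*} D(\xi)=0,\qquad (\mathrm{ad}\,\xi)^s=0,\qquad (\mathrm{ad}\,b)^*(\xi)=0,\\ D^a(d\eta)=0,\qquad D^a(b)=-\tau\xi,\\ \eta\wedge x^\flat=\tfrac14\alpha_x-\tfrac14(\mathrm{ad}\,x)^*(d\eta)+\tfrac14 d(\mathcal L_x\eta)+\tau\, b^\flat\wedge D^s(x)^\flat,\\ D^s(x)\lrcorner\, d\eta+x\lrcorner\, db^\flat+b\lrcorner\, dx^\flat+[x,b]^\flat=0. \end{gather*} Then $\phi$ is given by $$\phi(w)=\tfrac12(\mathrm{ad}\,w)^*(\xi)+\tau g(b,w)e_0,\qquad \phi(e_0)=-b,\qquad w\in\mathfrak g.$$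
   Context: All structures are left-invariant and are described on a real finite-dimensional Lie algebra; a (pseudo-Riemannian) metric on a Lie algebra is a nondegenerate symmetric bilinear form of arbitrary signature. $\tilde{\mathfrak g}=\mathfrak g\rtimes_D\mathrm{Span}\{e_0\}$ is the Lie algebra $\mathfrak g\oplus\mathbb R e_0$ with $[e_0,v]=Dv$ for $v\in\mathfrak g$; $e^0$ is the $1$-form with $e^0(e_0)=1$, $e^0|_{\mathfrak g}=0$, and $g$ is extended to $\tilde{\mathfrak g}$ by zero on $e_0$ (so $\mathfrak g\perp e_0$ in $\tilde g$). In the displayed conditions all of $[\,,\,]$, $\mathrm{ad}$, $d$, ${}^\flat$ and transposes refer to $(\mathfrak g,g)$: $x^\flat=g(x,\cdot)$, $d\alpha(x,y)=-\alpha([x,y])$ for $1$-forms, $\alpha\wedge\beta=\alpha\otimes\beta-\beta\otimes\alpha$, $\mathcal L_x\eta=x\lrcorner\, d\eta$, where $x\lrcorner\,$ is interior product. For an endomorphism $f$, $f^*$ is the metric adjoint, $f^s=\frac12(f+f^* )$, $f^a=\frac12(f-f^* )$. An endomorphism $f$ acts on a $2$-form $\beta$ by $(f\beta)(u,w)=-\beta(fu,w)-\beta(u,fw)$. An almost contact metric structure on a Lie algebra of dimension $2n+1$ is $(\phi,\xi,\eta,\tilde g)$ with $\phi$ an endomorphism, $\xi$ a vector, $\eta$ a $1$-form and $\tilde g$ a metric such that $\eta(\xi)=1$, $\eta\circ\phi=0$, $\phi^2=-\mathrm{Id}+\eta\otimes\xi$, $\tilde g(\xi,\xi)=1$, $\eta=\tilde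 g(\xi,\cdot)$, $\tilde g(\phi x,\phi y)=\tilde g(x,y)-\eta(x)\eta(y)$. Its fundamental form is $\Phi=\tilde g(\cdot,\phi\,\cdot)$. It is Sasaki if $d\eta=2\Phi$ and $N_\phi+d\eta\otimes\xi=0$ (with $d$ the differential of the Lie algebra on which the structure lives), where $N_\phi(x,y)=\phi^2[x,y]+[\phi x,\phi y]-\phi[\phi x,y]-\phi[x,\phi y]$.
   Formalization: The conditions on ξ are taken together with g(ξ,ξ)=1, since otherwise ξ=0 satisfies all of them (e.g. 𝔤=ℝ, D=0, where no Sasaki structure exists); almost contact metric structures are taken in dimension 2n+1 with n≥1, which only matters for 𝔤=0. *)

theory Defs
  imports "HOL-Analysis.Analysis"
begin

section \<open>Lie algebras\<close>

text \<open>The underlying vector space is a whole type \<open>'a::real_vector\<close>. The class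
  \<open>euclidean_space\<close> is not used, so that no auxiliary inner product is present;
  finite-dimensionality is part of the definition.\<close>

definition lie_algebra :: "('a::real_vector \<Rightarrow> 'a \<Rightarrow> 'a) \<Rightarrow> bool" where
  "lie_algebra br \<longleftrightarrow>
     (\<exists>B::'a set. finite B \<and> span B = UNIV) \<and>
     bilinear br \<and>
     (\<forall>x. br x x = 0) \<and>
     (\<forall>x y z. br x (br y z) + br y (br z x) + br z (br x y) = 0)"

primrec lower_central :: "('a::real_vector \<Rightarrow> 'a \<Rightarrow> 'a) \<Rightarrow> nat \<Rightarrow> 'a set" where
  "lower_central br 0 = UNIV"
| "lower_central br (Suc k) = span {br x y | x y. y \<in> lower_central br k}"

definition nilpotent_lie_algebra :: "('a::real_vector \<Rightarrow> 'a \<Rightarrow> 'a) \<Rightarrow> bool" where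
  "nilpotent_lie_algebra br \<longleftrightarrow> lie_algebra br \<and> (\<exists>k. lower_central br k = {0})"

definition derivation :: "('a::real_vector \<Rightarrow> 'a \<Rightarrow> 'a) \<Rightarrow> ('a \<Rightarrow> 'a) \<Rightarrow> bool" where
  "derivation br D \<longleftrightarrow> linear D \<and> (\<forall>x y. D (br x y) = br (D x) y + br x (D y))"

text \<open>The pair \<open>(u, s)\<close> stands for \<open>u + s e\<^sub>0\<close>, so \<open>e\<^sub>0 = (0, 1)\<close> and the form \<open>e\<^sup>0\<close> is \<^term>\<open>snd\<close>.\<close>

definition semidirect :: "('a::real_vector \<Rightarrow> 'a \<Rightarrow> 'a) \<Rightarrow> ('a \<Rightarrow> 'a) \<Rightarrow> 'a \<times> real \<Rightarrow> 'a \<times> real \<Rightarrow> 'a \<times> real" where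
  "semidirect br D p q = (br (fst p) (fst q) + snd p *\<^sub>R D (fst q) - snd q *\<^sub>R D (fst p), 0)"

section \<open>Metrics and forms\<close>

definition pseudo_metric :: "('a::real_vector \<Rightarrow> 'a \<Rightarrow> real) \<Rightarrow> bool" where
  "pseudo_metric g \<longleftrightarrow> bilinear g \<and> (\<forall>x y. g x y = g y x) \<and> (\<forall>x. (\<forall>y. g x y = 0) \<longrightarrow> x = 0)"

definition extend_metric :: "('a::real_vector \<Rightarrow> 'a \<Rightarrow> real) \<Rightarrow> real \<Rightarrow> 'a \<times> real \<Rightarrow> 'a \<times> real \<Rightarrow> real" where
  "extend_metric g \<tau> p q = g (fst p) (fst q) + \<tau> * (snd p * snd q)"

definition flat :: "('a \<Rightarrow> 'a \<Rightarrow> real) \<Rightarrow> 'a \<Rightarrow> 'a \<Rightarrow> real" where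
  "flat g x = (\<lambda>y. g x y)"

text \<open>For a metric on a finite-dimensional space and a linear \<open>f\<close> the adjoint exists and is unique,
  and it is then linear. The library's \<^const>\<open>adjoint\<close> only covers inner products.\<close>

definition metric_adjoint :: "('a \<Rightarrow> 'a \<Rightarrow> real) \<Rightarrow> ('a \<Rightarrow> 'a) \<Rightarrow> 'a \<Rightarrow> 'a" where
  "metric_adjoint g f = (THE h. \<forall>x y. g (f x) y = g x (h y))"

definition sym_part :: "('a::real_vector \<Rightarrow> 'a \<Rightarrow> real) \<Rightarrow> ('a \<Rightarrow> 'a) \<Rightarrow> 'a \<Rightarrow> 'a" where
  "sym_part g f = (\<lambda>x. (1/2) *\<^sub>R (f x + metric_adjoint g f x))"

definition skew_part :: "('a::real_vector \<Rightarrow> 'a \<Rightarrow> real) \<Rightarrow> ('a \<Rightarrow> 'a) \<Rightarrow> 'a \<Rightarrow> 'a" where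
  "skew_part g f = (\<lambda>x. (1/2) *\<^sub>R (f x - metric_adjoint g f x))"

definition ext_d :: "('a \<Rightarrow> 'a \<Rightarrow> 'a) \<Rightarrow> ('a \<Rightarrow> real) \<Rightarrow> 'a \<Rightarrow> 'a \<Rightarrow> real" where
  "ext_d br \<alpha> = (\<lambda>x y. - \<alpha> (br x y))"

definition wedge :: "('a \<Rightarrow> real) \<Rightarrow> ('a \<Rightarrow> real) \<Rightarrow> 'a \<Rightarrow> 'a \<Rightarrow> real" where
  "wedge \<alpha> \<beta> = (\<lambda>u w. \<alpha> u * \<beta> w - \<beta> u * \<alpha> w)"

definition interior_product :: "'a \<Rightarrow> ('a \<Rightarrow> 'a \<Rightarrow> real) \<Rightarrow> 'a \<Rightarrow> real" where
  "interior_product x \<beta> = (\<lambda>y. \<beta> x y)"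

text \<open>The Cartan formula for the Lie derivative of a left-invariant 1-form along a left-invariant
  vector field; the term \<open>d(\<eta>(x))\<close> vanishes.\<close>

definition lie_derivative :: "('a \<Rightarrow> 'a \<Rightarrow> 'a) \<Rightarrow> 'a \<Rightarrow> ('a \<Rightarrow> real) \<Rightarrow> 'a \<Rightarrow> real" where
  "lie_derivative br x \<eta> = interior_product x (ext_d br \<eta>)"

definition act2 :: "('a \<Rightarrow> 'a) \<Rightarrow> ('a \<Rightarrow> 'a \<Rightarrow> real) \<Rightarrow> 'a \<Rightarrow> 'a \<Rightarrow> real" where
  "act2 f \<beta> = (\<lambda>u w. - \<beta> (f u) w - \<beta> u (f w))"

section \<open>Sasaki structures\<close>

text \<open>The dimension is \<open>2 n + 1\<close> with \<open>n \<ge> 1\<close>: one-dimensional algebras are excluded. In dimension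
  at least two, the algebraic identities already force \<open>dim\<close> to be odd and at least three.\<close>

definition almost_contact_metric ::
  "('a::real_vector \<Rightarrow> 'a) \<Rightarrow> 'a \<Rightarrow> ('a \<Rightarrow> real) \<Rightarrow> ('a \<Rightarrow> 'a \<Rightarrow> real) \<Rightarrow> bool" where
  "almost_contact_metric \<phi> \<xi> \<eta> g \<longleftrightarrow>
     (\<exists>n::nat. n \<ge> 1 \<and> dim (UNIV::'a set) = 2 * n + 1) \<and>
     linear \<phi> \<and> linear \<eta> \<and> pseudo_metric g \<and>
     \<eta> \<xi> = 1 \<and>
     (\<forall>x. \<eta> (\<phi> x) = 0) \<and>
     (\<forall>x. \<phi> (\<phi> x) = - x + \<eta> x *\<^sub>R \<xi>) \<and>
     g \<xi> \<xi> = 1 \<and>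
     \<eta> = flat g \<xi> \<and>
     (\<forall>x y. g (\<phi> x) (\<phi> y) = g x y - \<eta> x * \<eta> y)"

definition fundamental_form :: "('a \<Rightarrow> 'a) \<Rightarrow> ('a \<Rightarrow> 'a \<Rightarrow> real) \<Rightarrow> 'a \<Rightarrow> 'a \<Rightarrow> real" where
  "fundamental_form \<phi> g = (\<lambda>x y. g x (\<phi> y))"

definition nijenhuis :: "('a::real_vector \<Rightarrow> 'a \<Rightarrow> 'a) \<Rightarrow> ('a \<Rightarrow> 'a) \<Rightarrow> 'a \<Rightarrow> 'a \<Rightarrow> 'a" where
  "nijenhuis br \<phi> x y = \<phi> (\<phi> (br x y)) + br (\<phi> x) (\<phi> y) - \<phi> (br (\<phi> x) y) - \<phi> (br x (\<phi> y))"

definition sasaki ::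
  "('a::real_vector \<Rightarrow> 'a \<Rightarrow> 'a) \<Rightarrow> ('a \<Rightarrow> 'a) \<Rightarrow> 'a \<Rightarrow> ('a \<Rightarrow> real) \<Rightarrow> ('a \<Rightarrow> 'a \<Rightarrow> real) \<Rightarrow> bool" where
  "sasaki br \<phi> \<xi> \<eta> g \<longleftrightarrow>
     almost_contact_metric \<phi> \<xi> \<eta> g \<and>
     (\<forall>x y. ext_d br \<eta> x y = 2 * fundamental_form \<phi> g x y) \<and>
     (\<forall>x y. nijenhuis br \<phi> x y + ext_d br \<eta> x y *\<^sub>R \<xi> = 0)"

section \<open>The conditions on the nilpotent algebra\<close>

definition alpha_form ::
  "('a::real_vector \<Rightarrow> 'a \<Rightarrow> 'a) \<Rightarrow> ('a \<Rightarrow> 'a \<Rightarrow> real) \<Rightarrow> ('a \<Rightarrow> real) \<Rightarrow> 'a \<Rightarrow> 'a \<Rightarrow> 'a \<Rightarrow> real" where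
  "alpha_form br g \<eta> x = (\<lambda>u w.
     ext_d br \<eta> (metric_adjoint g (br u) x) w - ext_d br \<eta> (metric_adjoint g (br w) x) u)"

definition sasaki_conditions ::
  "('a::real_vector \<Rightarrow> 'a \<Rightarrow> 'a) \<Rightarrow> ('a \<Rightarrow> 'a \<Rightarrow> real) \<Rightarrow> ('a \<Rightarrow> 'a) \<Rightarrow> real \<Rightarrow> 'a \<Rightarrow> bool" where
  "sasaki_conditions br g D \<tau> \<xi> \<longleftrightarrow>
    (let b = skew_part g D \<xi>; \<eta> = flat g \<xi> in
       D \<xi> = 0 \<and>
       (\<forall>x. sym_part g (br \<xi>) x = 0) \<and>
       metric_adjoint g (br b) \<xi> = 0 \<and>
       (\<forall>u w. act2 (skew_part g D) (ext_d br \<eta>) u w = 0) \<and>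
       skew_part g D b = - (\<tau> *\<^sub>R \<xi>) \<and>
       (\<forall>x u w. wedge \<eta> (flat g x) u w =
            1/4 * alpha_form br g \<eta> x u w
          - 1/4 * act2 (metric_adjoint g (br x)) (ext_d br \<eta>) u w
          + 1/4 * ext_d br (lie_derivative br x \<eta>) u w
          + \<tau> * wedge (flat g b) (flat g (sym_part g D x)) u w) \<and>
       (\<forall>x y. interior_product (sym_part g D x) (ext_d br \<eta>) y
          + interior_product x (ext_d br (flat g b)) y
          + interior_product b (ext_d br (flat g x)) y
          + flat g (br x b) y = 0))"

text \<open>The linear map with \<open>w \<mapsto> \<onehalf> (ad w)\<^sup>* \<xi> + \<tau> g(b,w) e\<^sub>0\<close> on \<open>\<gg>\<close> and \<open>e\<^sub>0 \<mapsto> - b\<close>.\<close>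

definition sasaki_phi ::
  "('a::real_vector \<Rightarrow> 'a \<Rightarrow> 'a) \<Rightarrow> ('a \<Rightarrow> 'a \<Rightarrow> real) \<Rightarrow> ('a \<Rightarrow> 'a) \<Rightarrow> real \<Rightarrow> 'a \<Rightarrow> 'a \<times> real \<Rightarrow> 'a \<times> real" where
  "sasaki_phi br g D \<tau> \<xi> p =
    (let b = skew_part g D \<xi>; w = fst p in
       ((1/2) *\<^sub>R metric_adjoint g (br w) \<xi>, \<tau> * g b w) + snd p *\<^sub>R (- b, 0))"

end

theory Submission
  imports Defs
begin

text \<open>
Write \<open>\<nabla>\<close> for the Levi-Civita connection. A metric structure with \<open>d\<eta> = 2\<Phi>\<close> is Sasaki exactly if
\<open>\<xi>\<close> is Killing and \<open>(\<nabla>\<^sub>x \<phi>) y = g(x,y) \<xi> - \<eta>(y) x\<close>. The theorem is this criterion, written out in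
components on \<open>\<gg> \<oplus> \<real> e\<^sub>0\<close>.

The criterion holds on every Lie algebra with a metric. From the equation for \<open>\<nabla>\<phi>\<close> the tensor \<open>N\<^sub>\<phi>\<close> can be
computed, and at \<open>y = \<xi>\<close> the equation gives \<open>\<phi>\<^sup>2 = -1 + \<eta> \<otimes> \<xi>\<close>, because \<open>\<nabla>\<^sub>x \<xi>\<close> is \<open>-\<phi> x\<close> for a
Killing field with \<open>d\<eta> = 2\<Phi>\<close> (\<open>nabla_imp_sasaki\<close>). Conversely, on a Sasaki algebra \<open>ad \<xi>\<close> commutes with \<open>\<phi>\<close>
and preserves \<open>d\<eta>\<close>, hence is skew (\<open>sasaki_imp_killing\<close>); the difference \<open>R\<close> of the two sides of the
equation satisfies the homogeneous identities that force \<open>\<nabla>J = 0\<close> on a Kaehler manifold, so it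
vanishes (\<open>sasaki_imp_nabla\<close>).

Nilpotency provides a nonzero central vector \<open>z\<close> of \<open>\<gg>\<close>. On \<open>\<gg> \<rtimes> \<real> e\<^sub>0\<close> the 1-form \<open>d\<eta>(z, \<cdot>)\<close> is a
multiple of \<open>e\<^sup>0\<close> and kills the Reeb vector; if the latter had a component along \<open>e\<^sub>0\<close>, then \<open>d\<eta>(z, \<cdot>)\<close>
would be zero and \<open>z\<close> would be a multiple of the Reeb vector, which is absurd. So the Reeb vector is some
\<open>\<xi> \<in> \<gg>\<close>, and skewness of \<open>ad \<xi>\<close> gives \<open>D \<xi> = 0\<close> (\<open>sasaki_reeb_horizontal\<close>).

Given \<open>D \<xi> = 0\<close>, the equation \<open>d\<eta> = 2\<Phi>\<close> amounts to the formula for \<open>\<phi>\<close>, and \<open>\<xi>\<close> is Killing exactly if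
\<open>(ad \<xi>)\<^sup>s = 0\<close>. The expression \<open>g((\<nabla>\<^sub>x \<phi>) y, z)\<close> is skew in \<open>y, z\<close>, so it has four types of components, and
each of them is one of the remaining conditions (\<open>nabla_phi_equation_iff\<close>). The condition \<open>(ad b)\<^sup>* \<xi> = 0\<close>
is the \<open>\<gg>\<close>-part of \<open>\<phi>\<^sup>2 e\<^sub>0 = - e\<^sub>0\<close>.
\<close>

section \<open>Metric adjoints\<close>

text \<open>The values \<open>g b y\<close> on a basis determine \<open>y\<close> because \<open>g\<close> is nondegenerate. Hence the endomorphism
  with coordinates \<open>g b y\<close> is injective, and so surjective: any values on the basis occur.\<close>

lemma linear_functional_represented_by_metric:
  fixes g :: "'a::real_vector \<Rightarrow> 'a \<Rightarrow> real" and f :: "'a \<Rightarrow> real"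
  assumes fd: "\<exists>B::'a set. finite B \<and> span B = UNIV"
    and g: "pseudo_metric g" and f: "linear f"
  shows "\<exists>z. \<forall>x. f x = g x z"
proof -
  obtain B0 :: "'a set" where B0: "finite B0" "span B0 = UNIV" using fd by blast
  obtain B where B: "B \<subseteq> B0" "independent B" "B0 \<subseteq> span B"
    using real_vector.maximal_independent_subset[of B0] by blast
  have finB: "finite B" using B B0 finite_subset by blast
  have spB: "span B = UNIV"
    using real_vector.span_minimal[OF B(3) real_vector.subspace_span] B0(2) by auto
  interpret fd: finite_dimensional_vector_space "scaleR :: real \<Rightarrow> 'a \<Rightarrow> 'a" B
    rewrites "module.dependent (scaleR :: real \<Rightarrow> 'a \<Rightarrow> 'a) = dependent"
      and "module.span (scaleR :: real \<Rightarrow> 'a \<Rightarrow> 'a) = span"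
      and "Vector_Spaces.linear (scaleR :: real \<Rightarrow> 'a \<Rightarrow> 'a) (scaleR :: real \<Rightarrow> 'a \<Rightarrow> 'a) = linear"
    by unfold_locales (auto simp: finB B(2) spB dependent_raw_def[symmetric] span_raw_def[symmetric]
        linear_def[symmetric])
  have bil: "bilinear g" using g by (simp add: pseudo_metric_def)
  note gs = bilinear_ladd[OF bil] bilinear_radd[OF bil] bilinear_lmul[OF bil] bilinear_rmul[OF bil]
  define T where "T y = (\<Sum>b\<in>B. g b y *\<^sub>R b)" for y
  have lT: "linear T"
    by (rule linearI) (simp_all add: T_def gs scaleR_add_left sum.distrib scaleR_sum_right)
  have ext: "h x = k x" if "linear h" "linear k" "\<And>b. b \<in> B \<Longrightarrow> h b = k b" for h k :: "'a \<Rightarrow> real" and x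
    using linear_eq_on[OF that(1,2), of x B] that(3) spB by auto
  have lg: "linear (\<lambda>x. g x y)" for y using bil by (simp add: bilinear_def)
  have coeff: "g b y = c b" if "T y = (\<Sum>b\<in>B. c b *\<^sub>R b)" "b \<in> B" for y c b
  proof -
    have "(\<Sum>b\<in>B. (g b y - c b) *\<^sub>R b) = 0"
      using that(1) by (simp add: T_def scaleR_diff_left sum_subtractf)
    then show ?thesis
      using real_vector.independentD[OF B(2) finB subset_refl, of "\<lambda>b. g b y - c b"] that(2) by auto
  qed
  have "inj T"
  proof (rule linear_injective_0[OF lT, THEN iffD2], intro allI impI)
    fix y assume "T y = 0"
    then have "g b y = 0" if "b \<in> B" for b using coeff[of y "\<lambda>_. 0"] that by auto
    then have "g x y = 0" for x
      using ext[OF lg, of "\<lambda>_. 0"] by (auto simp: linear_iff)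
    then show "y = 0" using g by (auto simp: pseudo_metric_def)
  qed
  then have "surj T" using fd.linear_inj_imp_surj[OF lT] by simp
  then obtain z where z: "T z = (\<Sum>b\<in>B. f b *\<^sub>R b)" by (auto simp: surj_def dest: spec[of _ "\<Sum>b\<in>B. f b *\<^sub>R b"])
  have "f x = g x z" for x
  proof (rule ext[OF f lg])
    show "f b = g b z" if "b \<in> B" for b using coeff[OF z that] by simp
  qed
  then show ?thesis by blast
qed

section \<open>Lie algebras with a metric\<close>

locale metric_lie_algebra =
  fixes br :: "'a::real_vector \<Rightarrow> 'a \<Rightarrow> 'a" and g :: "'a \<Rightarrow> 'a \<Rightarrow> real"
  assumes lie: "lie_algebra br" and metric: "pseudo_metric g"
begin

lemma bilinear_br: "bilinear br" and bilinear_g: "bilinear g"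
  using lie metric by (auto simp: lie_algebra_def pseudo_metric_def)

lemmas br_simps = bilinear_ladd[OF bilinear_br] bilinear_radd[OF bilinear_br]
  bilinear_lmul[OF bilinear_br] bilinear_rmul[OF bilinear_br]
  bilinear_lneg[OF bilinear_br] bilinear_rneg[OF bilinear_br]
  bilinear_lzero[OF bilinear_br] bilinear_rzero[OF bilinear_br]
  bilinear_lsub[OF bilinear_br] bilinear_rsub[OF bilinear_br]

lemmas g_simps = bilinear_ladd[OF bilinear_g] bilinear_radd[OF bilinear_g]
  bilinear_lmul[OF bilinear_g] bilinear_rmul[OF bilinear_g]
  bilinear_lneg[OF bilinear_g] bilinear_rneg[OF bilinear_g]
  bilinear_lzero[OF bilinear_g] bilinear_rzero[OF bilinear_g]
  bilinear_lsub[OF bilinear_g] bilinear_rsub[OF bilinear_g]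

lemma g_sym: "g x y = g y x"
  using metric by (auto simp: pseudo_metric_def)

lemma br_self: "br x x = 0"
  using lie by (auto simp: lie_algebra_def)

lemma br_skew: "br x y = - br y x"
proof -
  have "br (x + y) (x + y) = br x x + br x y + br y x + br y y" by (simp add: br_simps algebra_simps)
  then show ?thesis by (simp add: br_self eq_neg_iff_add_eq_0)
qed

lemma jacobi: "br x (br y z) + br y (br z x) + br z (br x y) = 0"
  using lie by (auto simp: lie_algebra_def)

lemma eq_by_metric:
  assumes "\<And>z. g x z = g y z" shows "x = y"
proof -
  have "\<forall>z. g (x - y) z = 0" using assms by (simp add: g_simps)
  then have "x - y = 0" using metric unfolding pseudo_metric_def by blast
  then show ?thesis by simp
qed

lemma linear_br: "linear (br x)"
  using bilinear_br by (simp add: bilinear_def)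

lemma adjoint_works:
  assumes "linear f"
  shows "g (f x) y = g x (metric_adjoint g f y)"
proof -
  have "\<exists>z. \<forall>x. g (f x) y = g x z" for y
  proof (rule linear_functional_represented_by_metric[OF _ metric])
    show "\<exists>B::'a set. finite B \<and> span B = UNIV" using lie by (auto simp: lie_algebra_def)
    show "linear (\<lambda>x. g (f x) y)"
      using assms by (auto simp: linear_iff g_simps)
  qed
  then obtain h where h: "\<And>x y. g (f x) y = g x (h y)" by metis
  have "metric_adjoint g f = h"
    unfolding metric_adjoint_def
  proof (rule the_equality)
    fix k assume "\<forall>x y. g (f x) y = g x (k y)"
    then have "g x (k y) = g x (h y)" for x y using h by metis
    then have "g (k y) x = g (h y) x" for x y by (simp add: g_sym[of _ x])
    then show "k = h" by (intro ext eq_by_metric)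
  qed (simp add: h)
  then show ?thesis using h by simp
qed

lemma adjoint_works':
  assumes "linear f"
  shows "g (metric_adjoint g f x) y = g x (f y)"
  using adjoint_works[OF assms] g_sym by metis

lemma sym_part_works:
  assumes "linear f"
  shows "g (sym_part g f x) y = (g (f x) y + g x (f y)) / 2"
  by (simp add: sym_part_def g_simps adjoint_works'[OF assms])

lemma skew_part_works:
  assumes "linear f"
  shows "g (skew_part g f x) y = (g (f x) y - g x (f y)) / 2"
  by (simp add: skew_part_def g_simps adjoint_works'[OF assms])

text \<open>Twice the Levi-Civita connection, \<open>2 g(\<nabla>\<^sub>x y, z)\<close>, by the Koszul formula for left-invariant
  vector fields.\<close>

definition koszul :: "'a \<Rightarrow> 'a \<Rightarrow> 'a \<Rightarrow> real" where
  "koszul x y z = g (br x y) z - g (br y z) x + g (br z x) y"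

text \<open>For a \<open>g\<close>-skew endomorphism \<open>\<phi>\<close> this is \<open>2 g((\<nabla>\<^sub>x \<phi>) y, z)\<close>.\<close>

definition nabla_endo :: "('a \<Rightarrow> 'a) \<Rightarrow> 'a \<Rightarrow> 'a \<Rightarrow> 'a \<Rightarrow> real" where
  "nabla_endo \<phi> x y z = koszul x (\<phi> y) z + koszul x y (\<phi> z)"

lemma koszul_skew: "koszul x y z = - koszul x z y"
  using br_skew[of z y] br_skew[of x z] br_skew[of x y]
  by (simp add: koszul_def g_simps)

lemma nabla_endo_skew: "nabla_endo \<phi> x y z = - nabla_endo \<phi> x z y"
  using koszul_skew[of x "\<phi> y" z] koszul_skew[of x "\<phi> z" y] by (simp add: nabla_endo_def)

lemma koszul_linear:
  "koszul (x + x') y z = koszul x y z + koszul x' y z"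
  "koszul x (y + y') z = koszul x y z + koszul x y' z"
  "koszul x y (z + z') = koszul x y z + koszul x y z'"
  "koszul (c *\<^sub>R x) y z = c * koszul x y z"
  "koszul x (c *\<^sub>R y) z = c * koszul x y z"
  "koszul x y (c *\<^sub>R z) = c * koszul x y z"
  by (simp_all add: koszul_def g_simps br_simps algebra_simps)

lemma koszul_neg:
  "koszul x (- y) z = - koszul x y z" "koszul x y (- z) = - koszul x y z"
  "koszul x 0 z = 0" "koszul x y 0 = 0"
  "koszul x (y - y') z = koszul x y z - koszul x y' z"
  "koszul x y (z - z') = koszul x y z - koszul x y z'"
  by (simp_all add: koszul_def g_simps br_simps)

end

section \<open>Sasaki structures and the covariant derivative of \<open>\<phi>\<close>\<close>

locale contact_metric = metric_lie_algebra br g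
  for br :: "'a::real_vector \<Rightarrow> 'a \<Rightarrow> 'a" and g :: "'a \<Rightarrow> 'a \<Rightarrow> real" +
  fixes \<phi> :: "'a \<Rightarrow> 'a" and \<xi> :: 'a
  assumes unit: "g \<xi> \<xi> = 1"
    and contact: "- g \<xi> (br x y) = 2 * g x (\<phi> y)"
begin

definition killing :: bool where
  "killing \<longleftrightarrow> (\<forall>x y. g (br \<xi> x) y = - g x (br \<xi> y))"

text \<open>This is \<open>(\<nabla>\<^sub>x \<phi>) y = g(x,y) \<xi> - \<eta>(y) x\<close>, paired with \<open>2z\<close>.\<close>

definition nabla_phi_equation :: bool where
  "nabla_phi_equation \<longleftrightarrow>
    (\<forall>x y z. nabla_endo \<phi> x y z = 2 * (g x y * g \<xi> z - g \<xi> y * g x z))"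

lemma phi_skew: "g (\<phi> x) y = - g x (\<phi> y)"
  using contact[of x y] contact[of y x] br_skew[of x y] g_sym[of "\<phi> x" y] by (simp add: g_simps)

lemma phi_linear: "linear \<phi>"
proof (rule linearI)
  show "\<phi> (x + y) = \<phi> x + \<phi> y" for x y
    by (rule eq_by_metric) (simp add: phi_skew g_simps)
  show "\<phi> (c *\<^sub>R x) = c *\<^sub>R \<phi> x" for c x
    by (rule eq_by_metric) (simp add: phi_skew g_simps)
qed

lemmas phi_simps = linear_add[OF phi_linear] linear_scale[OF phi_linear] linear_neg[OF phi_linear]
  linear_0[OF phi_linear] linear_diff[OF phi_linear]

text \<open>As the connection is torsion free, brackets may be replaced by covariant derivatives:
  \<open>N(x,y) = (\<nabla>\<^bsub>\<phi>x\<^esub>\<phi>) y - (\<nabla>\<^bsub>\<phi>y\<^esub>\<phi>) x - \<phi> (\<nabla>\<^sub>x\<phi>) y + \<phi> (\<nabla>\<^sub>y\<phi>) x\<close>.\<close>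

lemma nijenhuis_by_nabla:
  "2 * g (nijenhuis br \<phi> x y) z =
     nabla_endo \<phi> (\<phi> x) y z - nabla_endo \<phi> (\<phi> y) x z + nabla_endo \<phi> x y (\<phi> z) - nabla_endo \<phi> y x (\<phi> z)"
proof -
  have sk: "g (br p q) r = - g (br q p) r" for p q r
    by (subst br_skew) (simp add: g_simps)
  show ?thesis
    using sk[of "\<phi> x" "\<phi> y" z] sk[of "\<phi> y" z "\<phi> x"] sk[of z "\<phi> x" "\<phi> y"] sk[of "\<phi> x" y "\<phi> z"]
      sk[of y "\<phi> z" "\<phi> x"] sk[of "\<phi> z" "\<phi> x" y] sk[of "\<phi> x" z "\<phi> y"] sk[of z "\<phi> y" "\<phi> x"]
      sk[of "\<phi> y" x "\<phi> z"] sk[of x "\<phi> z" "\<phi> y"] sk[of "\<phi> z" "\<phi> y" x] sk[of x y "\<phi> (\<phi> z)"]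
      sk[of y "\<phi> (\<phi> z)" x] sk[of "\<phi> (\<phi> z)" x y]
    by (simp add: nijenhuis_def nabla_endo_def koszul_def g_simps phi_skew)
qed

text \<open>The cyclic sum is \<open>d\<Phi>\<close> up to a factor, and \<open>\<Phi>\<close> is exact; by hand, all terms cancel but those
  in which the Jacobi identity is paired with \<open>\<xi>\<close>.\<close>

lemma nabla_cyclic: "nabla_endo \<phi> x y z + nabla_endo \<phi> y z x + nabla_endo \<phi> z x y = 0"
proof -
  have sk: "g (br p q) r = - g (br q p) r" for p q r
    by (subst br_skew) (simp add: g_simps)
  have "g \<xi> (br (br x y) z) + g \<xi> (br (br y z) x) + g \<xi> (br (br z x) y) = 0"
    using arg_cong[OF jacobi[of x y z], of "g \<xi>"] br_skew[of x "br y z"] br_skew[of y "br z x"]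
      br_skew[of z "br x y"]
    by (simp add: g_simps)
  then have "g (br x y) (\<phi> z) + g (br y z) (\<phi> x) + g (br z x) (\<phi> y) = 0"
    using contact[of "br x y" z] contact[of "br y z" x] contact[of "br z x" y] by simp
  then show ?thesis
    using sk[of x "\<phi> y" z] sk[of y "\<phi> z" x] sk[of z "\<phi> x" y]
      sk[of "\<phi> x" y z] sk[of "\<phi> y" z x] sk[of "\<phi> z" x y]
    by (simp add: nabla_endo_def koszul_def)
qed

lemma killing_imp_phi_xi:
  assumes killing shows "\<phi> \<xi> = 0"
proof (rule eq_by_metric)
  fix x
  have "g \<xi> (br \<xi> x) = 0"
    using assms[unfolded killing_def, rule_format, of \<xi> x] by (simp add: br_self g_simps)
  then have "g x (\<phi> \<xi>) = 0"
    using contact[of x \<xi>] br_skew[of x \<xi>] by (simp add: g_simps)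
  then show "g (\<phi> \<xi>) x = g 0 x" using g_sym by (simp add: g_simps)
qed

text \<open>For a Killing field \<open>\<nabla>\<eta>\<close> is skew and thus equals half of \<open>d\<eta> = 2\<Phi>\<close>, so \<open>\<nabla>\<^sub>x \<xi> = - \<phi> x\<close>.\<close>

lemma killing_imp_koszul_xi:
  assumes killing shows "koszul x \<xi> z = 2 * g x (\<phi> z)"
proof -
  have "g (br x \<xi>) z = g x (br \<xi> z)"
    using assms[unfolded killing_def, rule_format, of x z] br_skew[of x \<xi>] by (simp add: g_simps)
  moreover have "g (br z x) \<xi> = 2 * g x (\<phi> z)"
    using contact[of x z] br_skew[of x z] g_sym[of "br z x" \<xi>] by (simp add: g_simps)
  ultimately show ?thesis using g_sym[of "br \<xi> z" x] by (simp add: koszul_def)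
qed

lemma killing_imp_nabla_xi:
  assumes killing shows "nabla_endo \<phi> x \<xi> z = 2 * g (\<phi> (\<phi> x)) z"
  using killing_imp_koszul_xi[OF assms] killing_imp_phi_xi[OF assms]
  by (simp add: nabla_endo_def koszul_neg phi_skew)

lemma phi_square_by_nabla:
  assumes killing nabla_phi_equation
  shows "\<phi> (\<phi> x) = - x + g \<xi> x *\<^sub>R \<xi>"
proof (rule eq_by_metric)
  fix z
  show "g (\<phi> (\<phi> x)) z = g (- x + g \<xi> x *\<^sub>R \<xi>) z"
    using killing_imp_nabla_xi[OF assms(1), of x z] assms(2)[unfolded nabla_phi_equation_def, rule_format, of x \<xi> z]
    by (simp add: g_simps unit g_sym[of x \<xi>])
qed

text \<open>A maximal independent set of odd size whose span contains \<open>\<xi>\<close> and is \<open>\<phi>\<close>-invariant spans the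
  whole space, since otherwise a pair \<open>w, \<phi> w\<close> could be added to it. A vector \<open>v\<close> outside the line of \<open>\<xi>\<close>
  excludes dimension one.\<close>

lemma odd_dimension:
  assumes sq: "\<And>x. \<phi> (\<phi> x) = - x + g \<xi> x *\<^sub>R \<xi>" and "\<phi> \<xi> = 0" and two: "v \<notin> span {\<xi>}"
  shows "\<exists>n::nat. n \<ge> 1 \<and> dim (UNIV :: 'a set) = 2 * n + 1"
proof -
  obtain B0 :: "'a set" where B0: "finite B0" "span B0 = UNIV"
    using lie by (auto simp: lie_algebra_def)
  define P where "P k \<longleftrightarrow> (\<exists>B. finite B \<and> independent B \<and> card B = 2 * k + 1 \<and> \<xi> \<in> span B \<and>
    (\<forall>x\<in>span B. \<phi> x \<in> span B))" for k
  have xi0: "\<xi> \<noteq> 0" using unit by (auto simp: g_simps)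
  have inv: "\<phi> x \<in> span {\<xi>}" if "x \<in> span {\<xi>}" for x
    using that assms(2) by (auto simp: real_vector.span_singleton phi_simps intro: exI[of _ 0])
  have P0: "P 0" unfolding P_def
    using xi0 inv by (intro exI[of _ "{\<xi>}"]) (auto intro: real_vector.span_base)
  have bound: "k \<le> card B0" if k: "P k" for k
  proof -
    obtain B :: "'a set" where "independent B" "card B = 2 * k + 1" using k by (auto simp: P_def)
    then show ?thesis using real_vector.independent_span_bound[of B0 B] B0 by auto
  qed
  obtain n where n: "P n" "\<And>m. P m \<Longrightarrow> m \<le> n"
    using P0 bound by (metis GreatestI_nat Greatest_le_nat)
  obtain B where B: "finite B" "independent B" "card B = 2 * n + 1" "\<xi> \<in> span B"
    "\<And>x. x\<in>span B \<Longrightarrow> \<phi> x \<in> span B" using n(1) by (auto simp: P_def)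
  have full: "span B = UNIV"
  proof (rule ccontr)
    assume "span B \<noteq> UNIV"
    then obtain w where w: "w \<notin> span B" by auto
    have indw: "independent (insert w B)" using w B(2) by (simp add: real_vector.independent_insert)
    have phiw: "\<phi> w \<notin> span (insert w B)"
    proof
      assume "\<phi> w \<in> span (insert w B)"
      then obtain a where a: "\<phi> w - a *\<^sub>R w \<in> span B" by (auto simp: real_vector.span_breakdown_eq)
      \<comment> \<open>Then \<open>\<phi>\<close> would have the real eigenvalue \<open>a\<close> modulo \<open>span B\<close>, although \<open>\<phi>\<^sup>2 = -1\<close> there.\<close>
      define s where "s = \<phi> w - a *\<^sub>R w"
      have "s \<in> span B" using a by (simp add: s_def)
      then have "g \<xi> w *\<^sub>R \<xi> - (\<phi> s + a *\<^sub>R s) \<in> span B"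
        using B(4,5) by (intro real_vector.span_diff real_vector.span_add real_vector.span_scale) auto
      moreover have "g \<xi> w *\<^sub>R \<xi> - (\<phi> s + a *\<^sub>R s) = (1 + a * a) *\<^sub>R w"
        by (simp add: s_def phi_simps sq algebra_simps)
      ultimately have "(1 + a * a) *\<^sub>R w \<in> span B" by simp
      then have "(1 / (1 + a * a)) *\<^sub>R ((1 + a * a) *\<^sub>R w) \<in> span B"
        by (rule real_vector.span_scale)
      moreover have "1 + a * a \<noteq> 0" by (smt (verit) zero_le_square)
      ultimately show False using w by simp
    qed
    let ?C = "insert (\<phi> w) (insert w B)"
    have "w \<notin> B" "\<phi> w \<notin> insert w B"
      using w phiw real_vector.span_base by blast+
    then have cardC: "card ?C = 2 * Suc n + 1" using B by simp
    have sub: "span B \<subseteq> span ?C" by (rule real_vector.span_mono) auto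
    have mem: "w \<in> span ?C" "\<phi> w \<in> span ?C" by (auto intro: real_vector.span_base)
    have "\<phi> x \<in> span ?C" if x: "x \<in> span ?C" for x
    proof -
      obtain a c where "x - a *\<^sub>R \<phi> w - c *\<^sub>R w \<in> span B" using x by (auto simp: real_vector.span_breakdown_eq)
      then have s: "\<phi> (x - a *\<^sub>R \<phi> w - c *\<^sub>R w) \<in> span ?C" using B(5) sub by blast
      have "\<phi> (x - a *\<^sub>R \<phi> w - c *\<^sub>R w) + a *\<^sub>R (- w + g \<xi> w *\<^sub>R \<xi>) + c *\<^sub>R \<phi> w \<in> span ?C"
        using s mem B(4) sub
        by (intro real_vector.span_add real_vector.span_scale real_vector.span_neg) auto
      then show ?thesis by (simp add: phi_simps sq)
    qed
    moreover have "independent ?C" using phiw indw by (simp add: real_vector.independent_insert)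
    ultimately have "P (Suc n)" unfolding P_def using cardC B(1,4) sub by (intro exI[of _ ?C]) auto
    then show False using n(2) by fastforce
  qed
  have dimB: "dim (UNIV :: 'a set) = 2 * n + 1"
    using real_vector.dim_eq_card[of B UNIV] B(2,3) full by simp
  moreover have "n \<noteq> 0"
  proof
    assume "n = 0"
    have "independent {v, \<xi>}" "v \<noteq> \<xi>"
      using two xi0 real_vector.span_base by (auto simp: real_vector.independent_insert)
    then have "2 \<le> card B"
      using real_vector.independent_span_bound[of B "{v, \<xi>}"] B(1) full by simp
    then show False using B(3) \<open>n = 0\<close> by simp
  qed
  ultimately show ?thesis by (intro exI[of _ n]) auto
qed

lemma nabla_imp_sasaki:
  assumes k: killing and n: nabla_phi_equation and two: "v \<notin> span {\<xi>}"
  shows "sasaki br \<phi> \<xi> (flat g \<xi>) g"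
proof -
  note sq = phi_square_by_nabla[OF k n] and p0 = killing_imp_phi_xi[OF k]
  have "nijenhuis br \<phi> x y + ext_d br (flat g \<xi>) x y *\<^sub>R \<xi> = 0" for x y
  proof (rule eq_by_metric)
    fix z
    have orth: "g \<xi> (\<phi> u) = 0" for u using phi_skew[of \<xi> u] p0 by (simp add: g_simps)
    have "2 * g (nijenhuis br \<phi> x y) z = 4 * (g (\<phi> x) y * g \<xi> z)"
      unfolding nijenhuis_by_nabla n[unfolded nabla_phi_equation_def, rule_format]
      by (simp add: orth phi_skew g_sym[of y "\<phi> x"] algebra_simps)
    then show "g (nijenhuis br \<phi> x y + ext_d br (flat g \<xi>) x y *\<^sub>R \<xi>) z = g 0 z"
      by (simp add: g_simps ext_d_def flat_def contact phi_skew)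
  qed
  moreover have "almost_contact_metric \<phi> \<xi> (flat g \<xi>) g"
    unfolding almost_contact_metric_def
  proof (intro conjI allI)
    show "\<exists>n::nat. n \<ge> 1 \<and> dim (UNIV :: 'a set) = 2 * n + 1" by (rule odd_dimension[OF sq p0 two])
    show "linear (flat g \<xi>)" by (auto simp: flat_def linear_iff g_simps)
    show "flat g \<xi> (\<phi> x) = 0" for x using phi_skew[of \<xi> x] p0 by (simp add: g_simps flat_def)
    show "g (\<phi> x) (\<phi> y) = g x y - flat g \<xi> x * flat g \<xi> y" for x y
      by (simp add: phi_skew sq g_simps flat_def g_sym[of x \<xi>])
  qed (simp_all add: phi_linear metric unit flat_def sq)
  ultimately show ?thesis
    by (simp add: sasaki_def ext_d_def flat_def contact fundamental_form_def)
qed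

text \<open>From \<open>\<phi>\<^sup>2 \<xi> = 0\<close> one gets \<open>0 = \<phi>\<^sup>2 (\<phi> \<xi>) = - \<phi> \<xi>\<close>.\<close>

lemma sasaki_imp_phi_xi:
  assumes "sasaki br \<phi> \<xi> \<eta> g" shows "\<phi> \<xi> = 0"
proof -
  have sq: "\<And>x. \<phi> (\<phi> x) = - x + \<eta> x *\<^sub>R \<xi>" and "\<eta> \<xi> = 1" "\<eta> (\<phi> \<xi>) = 0"
    using assms by (auto simp: sasaki_def almost_contact_metric_def)
  then have "\<phi> (\<phi> \<xi>) = 0" by simp
  then show ?thesis using sq[of "\<phi> \<xi>"] \<open>\<eta> (\<phi> \<xi>) = 0\<close> by (simp add: phi_simps)
qed

text \<open>The equation for \<open>N\<^sub>\<phi>\<close> at \<open>y = \<xi>\<close> says that \<open>ad \<xi>\<close> commutes with \<open>\<phi>\<close>. As a derivation with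
  \<open>\<eta> \<circ> ad \<xi> = 0\<close> it also preserves \<open>d\<eta> = 2 g(\<cdot>, \<phi> \<cdot>)\<close>, and therefore \<open>g\<close> on the image of \<open>\<phi>\<close>, which
  together with \<open>\<xi>\<close> spans everything.\<close>

lemma sasaki_imp_killing:
  assumes sas: "sasaki br \<phi> \<xi> \<eta> g" shows killing
proof -
  have eta: "\<eta> = flat g \<xi>" and sq: "\<And>x. \<phi> (\<phi> x) = - x + g \<xi> x *\<^sub>R \<xi>"
    and N: "\<And>x y. nijenhuis br \<phi> x y + ext_d br \<eta> x y *\<^sub>R \<xi> = 0"
    using sas by (auto simp: sasaki_def almost_contact_metric_def flat_def)
  note p0 = sasaki_imp_phi_xi[OF sas]
  have xi_br: "g \<xi> (br x \<xi>) = 0" for x using contact[of x \<xi>] p0 by (simp add: g_simps)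
  have *: "\<phi> (br (\<phi> x) \<xi>) = - br x \<xi>" for x
    using N[of x \<xi>] by (simp add: nijenhuis_def ext_d_def eta flat_def xi_br p0 br_simps phi_simps sq)
  have comm: "\<phi> (br \<xi> x) = br \<xi> (\<phi> x)" for x
  proof -
    have "\<phi> (\<phi> (br (\<phi> x) \<xi>)) = - \<phi> (br x \<xi>)" by (simp add: * phi_simps)
    then have "br (\<phi> x) \<xi> = \<phi> (br x \<xi>)" by (simp add: sq xi_br)
    then show ?thesis using br_skew[of "\<phi> x" \<xi>] br_skew[of x \<xi>] by (simp add: phi_simps)
  qed
  have image: "g (br \<xi> x) (\<phi> u) + g x (br \<xi> (\<phi> u)) = 0" for x u
  proof -
    have "br (br \<xi> x) u + br x (br \<xi> u) = br \<xi> (br x u)"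
      using jacobi[of \<xi> x u] br_skew[of "br \<xi> x" u] br_skew[of u \<xi>]
      by (simp add: br_simps add_eq_0_iff algebra_simps)
    then have "g \<xi> (br (br \<xi> x) u) + g \<xi> (br x (br \<xi> u)) = g \<xi> (br \<xi> (br x u))"
      by (metis bilinear_radd bilinear_g)
    moreover have "g \<xi> (br \<xi> (br x u)) = 0"
      using xi_br[of "br x u"] br_skew[of \<xi> "br x u"] by (simp add: g_simps)
    ultimately show ?thesis
      using contact[of "br \<xi> x" u] contact[of x "br \<xi> u"] comm by simp
  qed
  have "g (br \<xi> x) y = - g x (br \<xi> y)" for x y
  proof -
    have y: "y = \<phi> (- \<phi> y) + g \<xi> y *\<^sub>R \<xi>" by (simp add: phi_simps sq)
    have "g (br \<xi> x) \<xi> = 0" using xi_br[of x] br_skew[of \<xi> x] g_sym[of "br \<xi> x" \<xi>] by (simp add: g_simps)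
    moreover have "g (br \<xi> x) y = g (br \<xi> x) (\<phi> (- \<phi> y)) + g \<xi> y * g (br \<xi> x) \<xi>"
      by (subst y) (simp only: g_simps real_scaleR_def)
    moreover have "br \<xi> y = br \<xi> (\<phi> (- \<phi> y))"
      by (subst y) (simp add: br_simps br_self)
    ultimately show ?thesis using image[of x "- \<phi> y"] by simp
  qed
  then show ?thesis by (simp add: killing_def)
qed

text \<open>The difference \<open>R\<close> of the two sides inherits from \<open>\<nabla>\<phi>\<close> skewness (\<open>R_skew\<close>), the vanishing cyclic sum
  (\<open>R_cyc\<close>), the derivative of \<open>\<phi>\<^sup>2 = -1 + \<eta> \<otimes> \<xi>\<close> (\<open>R_shift\<close>) and the equation for \<open>N\<^sub>\<phi>\<close> (\<open>R_nij\<close>); the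
  inhomogeneous terms cancel in each. As in the proof that an almost Kaehler structure with vanishing Nijenhuis
  tensor is Kaehler, these four identities make \<open>R\<close> vanish when \<open>\<phi>\<close> is applied to the second argument.\<close>

lemma sasaki_imp_nabla:
  assumes sas: "sasaki br \<phi> \<xi> \<eta> g" shows nabla_phi_equation
proof -
  have eta: "\<eta> = flat g \<xi>" and sq: "\<And>x. \<phi> (\<phi> x) = - x + g \<xi> x *\<^sub>R \<xi>"
    and N: "\<And>x y. nijenhuis br \<phi> x y + ext_d br \<eta> x y *\<^sub>R \<xi> = 0"
    using sas by (auto simp: sasaki_def almost_contact_metric_def flat_def)
  note p0 = sasaki_imp_phi_xi[OF sas] and k = sasaki_imp_killing[OF sas]
  have orth: "g \<xi> (\<phi> u) = 0" for u using phi_skew[of \<xi> u] p0 by (simp add: g_simps)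
  define R where "R x y z = nabla_endo \<phi> x y z - 2 * (g x y * g \<xi> z - g \<xi> y * g x z)" for x y z
  have R_skew: "R x y z = - R x z y" for x y z
    using nabla_endo_skew[of \<phi> x y z] by (simp add: R_def)
  have R_cyc: "R x y z + R y z x + R z x y = 0" for x y z
    using nabla_cyclic[of x y z] g_sym[of x y] g_sym[of y z] g_sym[of x z] by (simp add: R_def algebra_simps)
  have R_shift: "R x (\<phi> y) z = R x y (\<phi> z)" for x y z
  proof -
    have "koszul x y \<xi> = - 2 * g x (\<phi> y)"
      using koszul_skew[of x y \<xi>] killing_imp_koszul_xi[OF k] by simp
    then have "nabla_endo \<phi> x (\<phi> y) z = nabla_endo \<phi> x y (\<phi> z) + 2 * g x (\<phi> y) * g \<xi> z + 2 * g x (\<phi> z) * g \<xi> y"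
      by (simp add: nabla_endo_def sq koszul_linear koszul_neg killing_imp_koszul_xi[OF k])
    then show ?thesis by (simp add: R_def orth algebra_simps)
  qed
  have R_nij: "R (\<phi> x) y z - R (\<phi> y) x z + R x y (\<phi> z) - R y x (\<phi> z) = 0" for x y z
  proof -
    have "g (nijenhuis br \<phi> x y) z = 2 * g (\<phi> x) y * g \<xi> z"
    proof -
      have "nijenhuis br \<phi> x y = - (ext_d br \<eta> x y *\<^sub>R \<xi>)" using N[of x y] by (simp add: add_eq_0_iff2)
      then show ?thesis by (simp add: ext_d_def eta flat_def g_simps contact phi_skew)
    qed
    then show ?thesis
      using nijenhuis_by_nabla[of x y z] by (simp add: R_def orth phi_skew g_sym[of y "\<phi> x"] algebra_simps)
  qed
  \<comment> \<open>By \<open>R_shift\<close> and \<open>R_cyc\<close>, the four terms of \<open>R_nij\<close> are \<open>R z (\<phi> y) x - R z (\<phi> x) y\<close>, and moving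
    \<open>\<phi>\<close> across shows that the two are opposite.\<close>
  have R_phi: "R z (\<phi> x) y = 0" for x y z
    using R_nij[of x y z] R_shift[of x y z] R_shift[of y x z] R_cyc[of "\<phi> x" y z] R_cyc[of "\<phi> y" x z]
      R_skew[of y "\<phi> x" z] R_skew[of x "\<phi> y" z] R_shift[of z x y] R_skew[of z "\<phi> y" x]
    by simp
  have R_xi: "R x \<xi> z = 0" for x z
    using killing_imp_nabla_xi[OF k] by (simp add: R_def sq g_simps unit g_sym[of x \<xi>])
  have "R x y z = 0" for x y z
  proof -
    have y: "y = \<phi> (- \<phi> y) + g \<xi> y *\<^sub>R \<xi>" by (simp add: phi_simps sq)
    have lin: "R x (u + c *\<^sub>R v) z = R x u z + c * R x v z" for u v c
      by (simp add: R_def nabla_endo_def koszul_linear phi_simps g_simps algebra_simps)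
    show ?thesis by (subst y) (simp add: lin R_phi R_xi)
  qed
  then show ?thesis by (simp add: R_def nabla_phi_equation_def)
qed

end

section \<open>Components on a semidirect product\<close>

locale semidirect_metric = metric_lie_algebra br g
  for br :: "'a::real_vector \<Rightarrow> 'a \<Rightarrow> 'a" and g :: "'a \<Rightarrow> 'a \<Rightarrow> real" +
  fixes D :: "'a \<Rightarrow> 'a" and \<tau> :: real
  assumes der: "derivation br D" and tau: "\<tau> = 1 \<or> \<tau> = - 1"
begin

lemma D_linear: "linear D" and D_br: "D (br x y) = br (D x) y + br x (D y)"
  using der by (auto simp: derivation_def)

lemmas D_simps = linear_add[OF D_linear] linear_scale[OF D_linear] linear_neg[OF D_linear]
  linear_0[OF D_linear] linear_diff[OF D_linear]

lemma semidirect_Pair [simp]: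
  "semidirect br D (x, a) (y, c) = (br x y + a *\<^sub>R D y - c *\<^sub>R D x, 0)"
  by (simp add: semidirect_def)

lemma extend_metric_Pair [simp]:
  "extend_metric g \<tau> (x, a) (y, c) = g x y + \<tau> * (a * c)"
  by (simp add: extend_metric_def)

lemma lie_algebra_semidirect: "lie_algebra (semidirect br D)"
  unfolding lie_algebra_def
proof (intro conjI allI)
  obtain B :: "'a set" where B: "finite B" "span B = UNIV"
    using lie by (auto simp: lie_algebra_def)
  define C where "C = insert (0, 1 :: real) ((\<lambda>x. (x, 0)) ` B)"
  have lin: "linear (\<lambda>x::'a. (x, 0::real))" by (simp add: linear_iff)
  have "(x, a) \<in> span C" for x a
  proof -
    have "(x, 0) \<in> span ((\<lambda>x. (x, 0::real)) ` B)"
      using B(2) by (simp add: linear_span_image[OF lin])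
    then have "(x, 0) \<in> span C"
      using real_vector.span_mono[of "(\<lambda>x. (x, 0)) ` B" C] by (auto simp: C_def)
    moreover have "a *\<^sub>R (0, 1) \<in> span C"
      by (intro real_vector.span_scale real_vector.span_base) (simp add: C_def)
    ultimately have "(x, 0) + a *\<^sub>R (0, 1) \<in> span C" by (rule real_vector.span_add)
    then show ?thesis by simp
  qed
  then show "\<exists>B :: ('a \<times> real) set. finite B \<and> span B = UNIV"
    using B(1) by (intro exI[of _ C]) (auto simp: C_def)
next
  show "bilinear (semidirect br D)"
    by (auto simp: bilinear_def linear_iff semidirect_def br_simps D_simps algebra_simps)
next
  fix p :: "'a \<times> real"
  show "semidirect br D p p = 0" by (simp add: semidirect_def br_self zero_prod_def)
next
  fix p q r :: "'a \<times> real"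
  obtain x a y b z c where pqr: "p = (x, a)" "q = (y, b)" "r = (z, c)" by (metis surj_pair)
  have sk: "br (D u) v = - br v (D u)" for u v by (rule br_skew)
  have "br x (br y z) + br y (br z x) + br z (br x y) = 0" by (rule jacobi)
  then have "br x (br y z + b *\<^sub>R D z - c *\<^sub>R D y) + a *\<^sub>R D (br y z + b *\<^sub>R D z - c *\<^sub>R D y)
    + (br y (br z x + c *\<^sub>R D x - a *\<^sub>R D z) + b *\<^sub>R D (br z x + c *\<^sub>R D x - a *\<^sub>R D z))
    + (br z (br x y + a *\<^sub>R D y - b *\<^sub>R D x) + c *\<^sub>R D (br x y + a *\<^sub>R D y - b *\<^sub>R D x)) = 0"
    by (simp add: br_simps D_simps D_br sk algebra_simps)
  then show "semidirect br D p (semidirect br D q r) + semidirect br D q (semidirect br D r p)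
      + semidirect br D r (semidirect br D p q) = 0"
    by (simp add: pqr zero_prod_def)
qed

lemma pseudo_metric_extend: "pseudo_metric (extend_metric g \<tau>)"
  unfolding pseudo_metric_def
proof (intro conjI allI impI)
  show "bilinear (extend_metric g \<tau>)"
    by (auto simp: bilinear_def linear_iff extend_metric_def g_simps algebra_simps)
  show "extend_metric g \<tau> p q = extend_metric g \<tau> q p" for p q
    by (simp add: extend_metric_def g_sym[of "fst p"])
next
  fix p assume p: "\<forall>q. extend_metric g \<tau> p q = 0"
  have "g (fst p) y = g 0 y" for y
    using p[rule_format, of "(y, 0)"] by (simp add: extend_metric_def g_simps)
  then have "fst p = 0" by (rule eq_by_metric)
  moreover have "snd p = 0"
    using p[rule_format, of "(0, 1)"] tau by (auto simp: extend_metric_def g_simps)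
  ultimately show "p = 0" by (simp add: prod_eq_iff)
qed

sublocale sd: metric_lie_algebra "semidirect br D" "extend_metric g \<tau>"
  by unfold_locales (rule lie_algebra_semidirect pseudo_metric_extend)+

end

text \<open>With \<open>D \<xi> = 0\<close> the formula for \<open>\<phi>\<close> is the unique solution of \<open>d\<eta> = 2\<Phi>\<close> for \<open>\<eta> = \<xi>\<^sup>\<flat>\<close>, so the
  criterion in terms of \<open>\<nabla>\<phi>\<close> applies to it.\<close>

locale semidirect_reeb = semidirect_metric br g D \<tau>
  for br :: "'a::real_vector \<Rightarrow> 'a \<Rightarrow> 'a" and g :: "'a \<Rightarrow> 'a \<Rightarrow> real" and D :: "'a \<Rightarrow> 'a" and \<tau> :: real +
  fixes \<xi> :: 'a
  assumes unit: "g \<xi> \<xi> = 1" and D_xi: "D \<xi> = 0"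
begin

abbreviation b :: 'a where "b \<equiv> skew_part g D \<xi>"

text \<open>The \<open>\<gg>\<close>-component of \<open>\<phi>\<close> on \<open>\<gg>\<close>; on \<open>\<gg>\<close> it represents half of \<open>d\<eta>\<close>.\<close>

definition A :: "'a \<Rightarrow> 'a" where
  "A w = (1/2) *\<^sub>R metric_adjoint g (br w) \<xi>"

lemma d_xi: "g \<xi> (br u w) = - 2 * g u (A w)"
  using adjoint_works[OF linear_br, of w u \<xi>] br_skew[of u w] g_sym[of "br w u" \<xi>]
  by (simp add: A_def g_simps)

lemma A_skew: "g (A u) w = - g u (A w)"
  using d_xi[of u w] d_xi[of w u] br_skew[of u w] g_sym[of "A u" w] by (simp add: g_simps)

lemma A_linear: "linear A"
proof (rule linearI)
  show "A (x + y) = A x + A y" for x y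
    by (rule eq_by_metric) (simp add: A_skew g_simps)
  show "A (c *\<^sub>R x) = c *\<^sub>R A x" for c x
    by (rule eq_by_metric) (simp add: A_skew g_simps)
qed

lemmas A_simps = linear_neg[OF A_linear] linear_0[OF A_linear]

lemma xi_D: "g \<xi> (D w) = - 2 * g b w"
  by (simp add: skew_part_works[OF D_linear] D_xi g_simps)

lemma sasaki_phi_Pair: "sasaki_phi br g D \<tau> \<xi> (w, c) = (A w - c *\<^sub>R b, \<tau> * g b w)"
  by (simp add: sasaki_phi_def A_def Let_def)

lemma tau_sq: "\<tau> * (\<tau> * r) = r"
  using tau by auto

sublocale sp: contact_metric "semidirect br D" "extend_metric g \<tau>" "sasaki_phi br g D \<tau> \<xi>" "(\<xi>, 0)"
proof
  show "extend_metric g \<tau> (\<xi>, 0) (\<xi>, 0) = 1" by (simp add: unit)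
next
  fix p q :: "'a \<times> real"
  obtain x a y c where pq: "p = (x, a)" "q = (y, c)" by (metis surj_pair)
  show "- extend_metric g \<tau> (\<xi>, 0) (semidirect br D p q) =
      2 * extend_metric g \<tau> p (sasaki_phi br g D \<tau> \<xi> q)"
    using tau_sq[of "a * g b y"]
    by (simp add: pq sasaki_phi_Pair g_simps d_xi xi_D g_sym[of x b] algebra_simps)
qed

lemma contact_imp_sasaki_phi:
  assumes "\<And>p q. - extend_metric g \<tau> (\<xi>, 0) (semidirect br D p q) = 2 * extend_metric g \<tau> p (\<phi> q)"
  shows "\<phi> = sasaki_phi br g D \<tau> \<xi>"
proof (rule ext, rule sd.eq_by_metric)
  fix q p
  show "extend_metric g \<tau> (\<phi> q) p = extend_metric g \<tau> (sasaki_phi br g D \<tau> \<xi> q) p"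
    using assms[of p q] sp.contact[of p q] sd.g_sym[of p] by simp
qed

lemma killing_iff: "sp.killing \<longleftrightarrow> (\<forall>x. sym_part g (br \<xi>) x = 0)"
proof
  assume sp.killing
  then have "g (br \<xi> x) y = - g x (br \<xi> y)" for x y
    unfolding sp.killing_def by (auto simp: D_xi dest!: spec[of _ "(x, 0)"] spec[of _ "(y, 0)"])
  then show "\<forall>x. sym_part g (br \<xi>) x = 0"
    by (auto intro!: eq_by_metric simp: sym_part_works[OF linear_br] g_simps)
next
  assume sym: "\<forall>x. sym_part g (br \<xi>) x = 0"
  have "g (br \<xi> x) y = - g x (br \<xi> y)" for x y
    using sym_part_works[OF linear_br, of \<xi> x y] sym by (simp add: g_simps)
  then show sp.killing
    by (auto simp: sp.killing_def D_xi)
qed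

abbreviation nabla :: "'a \<times> real \<Rightarrow> 'a \<times> real \<Rightarrow> 'a \<times> real \<Rightarrow> real" where
  "nabla \<equiv> sd.nabla_endo (sasaki_phi br g D \<tau> \<xi>)"

text \<open>Up to factors, the form \<open>\<alpha>\<^sub>x\<close> collects the terms with \<open>x\<close> outside the bracket and \<open>(ad x)\<^sup>* (d\<eta>)\<close> those with \<open>x\<close>
  bracketed with a \<open>\<phi>\<close>-image; the rest, in which \<open>x\<close> is bracketed with \<open>u\<close> or \<open>w\<close>, adds up to \<open>d(\<L>\<^sub>x \<eta>)\<close> by the
  Jacobi identity. The wedge product with \<open>b\<^sup>\<flat>\<close> comes from the \<open>e\<^sub>0\<close>-component of \<open>\<phi>\<close>. Names of the component
  lemmas list the summands in which the three arguments lie.\<close>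

lemma nabla_ggg:
  "nabla (x, 0) (u, 0) (w, 0) = - 2 * (1/4 * alpha_form br g (flat g \<xi>) x u w
     - 1/4 * act2 (metric_adjoint g (br x)) (ext_d br (flat g \<xi>)) u w
     + 1/4 * ext_d br (lie_derivative br x (flat g \<xi>)) u w
     + \<tau> * wedge (flat g b) (flat g (sym_part g D x)) u w)"
proof -
  have sk: "g (br p q) r = - g (br q p) r" for p q r
    by (subst br_skew) (simp add: g_simps)
  have ad: "g (metric_adjoint g (br p) q) r = g q (br p r)" for p q r
    by (rule adjoint_works'[OF linear_br])
  have ad': "g p (metric_adjoint g (br q) r) = g (br q p) r" for p q r
    using adjoint_works[OF linear_br] by simp
  have alpha: "alpha_form br g (flat g \<xi>) x u w = 2 * g x (br u (A w)) - 2 * g x (br w (A u))"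
    by (simp add: alpha_form_def ext_d_def flat_def d_xi ad)
  have act: "act2 (metric_adjoint g (br x)) (ext_d br (flat g \<xi>)) u w =
      - 2 * g u (br x (A w)) + 2 * g (br x (A u)) w"
    using br_skew[of u "metric_adjoint g (br x) w"] A_skew[of u "metric_adjoint g (br x) w"]
    by (simp add: act2_def ext_d_def flat_def d_xi ad ad' g_simps)
  have lie: "ext_d br (lie_derivative br x (flat g \<xi>)) u w = - 2 * g (br x u) (A w) - 2 * g (br w x) (A u)"
  proof -
    have "g \<xi> (br x (br u w)) + g \<xi> (br u (br w x)) + g \<xi> (br w (br x u)) = 0"
      using arg_cong[OF jacobi[of x u w], of "g \<xi>"] by (simp add: g_simps)
    moreover have "g \<xi> (br u (br w x)) = 2 * g (br w x) (A u)" "g \<xi> (br w (br x u)) = 2 * g (br x u) (A w)"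
      using br_skew[of u "br w x"] br_skew[of w "br x u"] by (simp_all add: g_simps d_xi)
    ultimately show ?thesis
      by (simp add: ext_d_def lie_derivative_def interior_product_def flat_def)
  qed
  show ?thesis
    unfolding alpha act lie
    using sk[of "A u" w x] sk[of "A w" x u] g_sym[of "br u (A w)" x] g_sym[of "br w (A u)" x]
      g_sym[of "br x (A w)" u] g_sym[of x "D w"] g_sym[of x "D u"]
    by (simp add: sd.nabla_endo_def sd.koszul_def sasaki_phi_Pair g_simps wedge_def flat_def
        sym_part_works[OF D_linear] field_simps)
qed

lemma nabla_geg:
  "nabla (x, 0) (0, 1) (w, 0) = - (interior_product (sym_part g D x) (ext_d br (flat g \<xi>)) w
     + interior_product x (ext_d br (flat g b)) w
     + interior_product b (ext_d br (flat g x)) w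
     + flat g (br x b) w)"
  using br_skew[of w x] g_sym[of "br x w" b] g_sym[of "br b w" x] g_sym[of x "D (A w)"]
  by (simp add: sd.nabla_endo_def sd.koszul_def sasaki_phi_Pair g_simps br_simps D_simps A_simps flat_def
      interior_product_def ext_d_def d_xi sym_part_works[OF D_linear] field_simps)

lemma nabla_egg:
  "nabla (0, 1) (u, 0) (w, 0) = - act2 (skew_part g D) (ext_d br (flat g \<xi>)) u w"
  using A_skew[of u "skew_part g D w"] g_sym[of "A u" "skew_part g D w"] g_sym[of u "D (A w)"]
    g_sym[of w "D (A u)"]
  by (simp add: sd.nabla_endo_def sd.koszul_def sasaki_phi_Pair g_simps br_simps D_simps flat_def
      act2_def ext_d_def d_xi skew_part_works[OF D_linear] field_simps)

lemma nabla_eeg: "nabla (0, 1) (0, 1) (w, 0) = - 2 * g (skew_part g D b) w"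
  using g_sym[of b "D w"]
  by (simp add: sd.nabla_endo_def sd.koszul_def sasaki_phi_Pair g_simps br_simps D_simps A_simps
      skew_part_works[OF D_linear])

text \<open>By skewness in the last two arguments the components of type \<open>eeg\<close>, \<open>egg\<close>, \<open>geg\<close> and \<open>ggg\<close> are all
  there are, and each of them is a nonzero multiple of the difference of the two sides of one condition.\<close>

lemma nabla_phi_equation_iff:
  "sp.nabla_phi_equation \<longleftrightarrow>
     (\<forall>u w. act2 (skew_part g D) (ext_d br (flat g \<xi>)) u w = 0) \<and>
     skew_part g D b = - (\<tau> *\<^sub>R \<xi>) \<and>
     (\<forall>x u w. wedge (flat g \<xi>) (flat g x) u w =
            1/4 * alpha_form br g (flat g \<xi>) x u w
          - 1/4 * act2 (metric_adjoint g (br x)) (ext_d br (flat g \<xi>)) u w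
          + 1/4 * ext_d br (lie_derivative br x (flat g \<xi>)) u w
          + \<tau> * wedge (flat g b) (flat g (sym_part g D x)) u w) \<and>
     (\<forall>x y. interior_product (sym_part g D x) (ext_d br (flat g \<xi>)) y
          + interior_product x (ext_d br (flat g b)) y
          + interior_product b (ext_d br (flat g x)) y
          + flat g (br x b) y = 0)" (is "?L \<longleftrightarrow> ?egg \<and> ?eeg \<and> ?ggg \<and> ?geg")
proof -
  let ?G = "extend_metric g \<tau>"
  define R where "R p q r = nabla p q r - 2 * (?G p q * ?G (\<xi>, 0) r - ?G (\<xi>, 0) q * ?G p r)" for p q r
  have L: "?L \<longleftrightarrow> (\<forall>p q r. R p q r = 0)"
    by (simp add: sp.nabla_phi_equation_def R_def)
  have egg: "?egg \<longleftrightarrow> (\<forall>u w. R (0, 1) (u, 0) (w, 0) = 0)"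
    by (simp add: R_def nabla_egg g_simps)
  have eeg: "?eeg \<longleftrightarrow> (\<forall>w. R (0, 1) (0, 1) (w, 0) = 0)"
  proof -
    have "?eeg \<longleftrightarrow> (\<forall>w. g (skew_part g D b) w = g (- (\<tau> *\<^sub>R \<xi>)) w)"
      by (metis eq_by_metric)
    moreover have "R (0, 1) (0, 1) (w, 0) = 2 * (g (- (\<tau> *\<^sub>R \<xi>)) w - g (skew_part g D b) w)" for w
      by (simp add: R_def nabla_eeg g_simps)
    ultimately show ?thesis by auto
  qed
  have ggg: "?ggg \<longleftrightarrow> (\<forall>x u w. R (x, 0) (u, 0) (w, 0) = 0)"
  proof -
    let ?E = "\<lambda>x u w. 1/4 * alpha_form br g (flat g \<xi>) x u w
      - 1/4 * act2 (metric_adjoint g (br x)) (ext_d br (flat g \<xi>)) u w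
      + 1/4 * ext_d br (lie_derivative br x (flat g \<xi>)) u w
      + \<tau> * wedge (flat g b) (flat g (sym_part g D x)) u w"
    have "R (x, 0) (u, 0) (w, 0) = 2 * (wedge (flat g \<xi>) (flat g x) u w - ?E x u w)" for x u w
      unfolding R_def nabla_ggg by (simp add: wedge_def flat_def)
    then have "R (x, 0) (u, 0) (w, 0) = 0 \<longleftrightarrow> wedge (flat g \<xi>) (flat g x) u w = ?E x u w" for x u w
      by (simp only: mult_eq_0_iff right_minus_eq) simp
    then show ?thesis by (simp only:)
  qed
  have geg: "?geg \<longleftrightarrow> (\<forall>x w. R (x, 0) (0, 1) (w, 0) = 0)"
  proof -
    let ?F = "\<lambda>x w. interior_product (sym_part g D x) (ext_d br (flat g \<xi>)) w
      + interior_product x (ext_d br (flat g b)) w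
      + interior_product b (ext_d br (flat g x)) w
      + flat g (br x b) w"
    have "R (x, 0) (0, 1) (w, 0) = - ?F x w" for x w
      unfolding R_def nabla_geg by (simp add: g_simps)
    then show ?thesis by (simp only: neg_equal_0_iff_equal)
  qed
  have sk: "R p q r = - R p r q" for p q r
    using sd.nabla_endo_skew[of "sasaki_phi br g D \<tau> \<xi>" p q r] by (simp add: R_def algebra_simps)
  have lin: "R (p + a *\<^sub>R p') q r = R p q r + a * R p' q r"
    "R p (q + a *\<^sub>R p') r = R p q r + a * R p p' r"
    "R p q (r + a *\<^sub>R p') = R p q r + a * R p q p'" for p p' q r a
    by (simp_all add: R_def sd.nabla_endo_def sd.koszul_linear sp.phi_simps sd.g_simps algebra_simps)
  have "R p q r = 0"
    if z: "\<And>u w. R (0, 1) (u, 0) (w, 0) = 0" "\<And>w. R (0, 1) (0, 1) (w, 0) = 0"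
      "\<And>x u w. R (x, 0) (u, 0) (w, 0) = 0" "\<And>x w. R (x, 0) (0, 1) (w, 0) = 0" for p q r
  proof -
    have split: "v = (fst v, 0) + snd v *\<^sub>R (0, 1)" for v :: "'a \<times> real" by (simp add: prod_eq_iff)
    have e: "R (0, 1) (u, 0) (0, 1) = 0" "R (x, 0) (u, 0) (0, 1) = 0" "R s (0, 1) (0, 1) = 0" for x u s
      using sk[of "(0, 1)" "(u, 0)" "(0, 1)"] sk[of "(x, 0)" "(u, 0)" "(0, 1)"] sk[of s "(0, 1)" "(0, 1)"] z
      by simp_all
    show ?thesis
      by (subst split[of p], subst split[of q], subst split[of r]) (simp only: lin z e, simp)
  qed
  then show ?thesis unfolding L egg eeg ggg geg by blast
qed

lemma phi_square_imp_adjoint_zero: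
  assumes "\<And>p. sasaki_phi br g D \<tau> \<xi> (sasaki_phi br g D \<tau> \<xi> p) = - p + extend_metric g \<tau> (\<xi>, 0) p *\<^sub>R (\<xi>, 0)"
  shows "metric_adjoint g (br b) \<xi> = 0"
proof -
  have "A b = 0" using assms[of "(0, 1)"] by (simp add: sasaki_phi_Pair A_simps g_simps)
  then show ?thesis by (simp add: A_def)
qed

lemma sasaki_phi_iff:
  "sasaki (semidirect br D) (sasaki_phi br g D \<tau> \<xi>) (\<xi>, 0) (flat (extend_metric g \<tau>) (\<xi>, 0)) (extend_metric g \<tau>)
     \<longleftrightarrow> sasaki_conditions br g D \<tau> \<xi>" (is "?S \<longleftrightarrow> ?C")
proof
  assume S: ?S
  have k: sp.killing and n: sp.nabla_phi_equation
    using sp.sasaki_imp_killing[OF S] sp.sasaki_imp_nabla[OF S] .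
  show ?C
    unfolding sasaki_conditions_def Let_def
    using k n D_xi phi_square_imp_adjoint_zero[OF sp.phi_square_by_nabla[OF k n]]
    by (simp only: killing_iff nabla_phi_equation_iff simp_thms)
next
  assume C: ?C
  have k: sp.killing and n: sp.nabla_phi_equation
    using C unfolding sasaki_conditions_def Let_def killing_iff nabla_phi_equation_iff by blast+
  have "(0, 1) \<notin> span {(\<xi>, 0::real)}" by (auto simp: real_vector.span_singleton)
  then show ?S by (rule sp.nabla_imp_sasaki[OF k n])
qed

end

section \<open>The Reeb vector lies in the nilpotent factor\<close>

text \<open>The last nonzero term of the lower central series is central.\<close>

lemma nilpotent_imp_central_vector:
  fixes br :: "'a::real_vector \<Rightarrow> 'a \<Rightarrow> 'a"
  assumes "nilpotent_lie_algebra br" and "v \<noteq> (0::'a)"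
  obtains z where "z \<noteq> 0" "\<And>x. br x z = 0"
proof -
  have ex: "\<exists>k. lower_central br k = {0}" using assms(1) by (simp add: nilpotent_lie_algebra_def)
  define k where "k = (LEAST k. lower_central br k = {0})"
  have k: "lower_central br k = {0}" unfolding k_def using ex by (rule LeastI_ex)
  have "k \<noteq> 0" using k assms(2) by (metis UNIV_I lower_central.simps(1) singletonD)
  then obtain j where j: "k = Suc j" by (cases k) auto
  have "lower_central br j \<noteq> {0}" using not_less_Least[of j "\<lambda>k. lower_central br k = {0}"] j k_def by auto
  moreover have "0 \<in> lower_central br j" by (cases j) (auto simp: real_vector.span_zero)
  ultimately obtain z where z: "z \<in> lower_central br j" "z \<noteq> 0" by auto
  have "br x z \<in> lower_central br k" for x using z(1) by (auto simp: j intro!: real_vector.span_base)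
  then show ?thesis using k z(2) that by auto
qed

context semidirect_metric
begin

text \<open>For \<open>z\<close> central in \<open>\<gg>\<close>, \<open>d\<eta>(z, \<cdot>)\<close> is a multiple of \<open>e\<^sup>0\<close>. It vanishes on the Reeb vector, so it is
  zero if the Reeb vector has an \<open>e\<^sub>0\<close>-component; but then \<open>\<phi> z = 0\<close>, which makes \<open>z\<close> a multiple of the Reeb
  vector. Finally \<open>D \<xi> = 0\<close> because brackets are orthogonal to \<open>e\<^sub>0\<close> and \<open>ad \<xi>\<close> is skew.\<close>

lemma sasaki_reeb_horizontal:
  assumes nil: "nilpotent_lie_algebra br"
    and sas: "sasaki (semidirect br D) \<phi> \<zeta> \<eta> (extend_metric g \<tau>)"
  obtains \<xi> where "\<zeta> = (\<xi>, 0)" "D \<xi> = 0"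
proof -
  have dim3: "\<exists>n::nat. n \<ge> 1 \<and> dim (UNIV::('a \<times> real) set) = 2 * n + 1"
    and sq: "\<And>p. \<phi> (\<phi> p) = - p + \<eta> p *\<^sub>R \<zeta>"
    using sas by (auto simp: sasaki_def almost_contact_metric_def)
  interpret c: contact_metric "semidirect br D" "extend_metric g \<tau>" \<phi> \<zeta>
    using sas by unfold_locales
      (auto simp: sasaki_def almost_contact_metric_def ext_d_def fundamental_form_def flat_def)
  obtain v s where zeta: "\<zeta> = (v, s)" by (cases \<zeta>)
  \<comment> \<open>Dimension three or more excludes \<open>\<gg> = 0\<close>, where there would be no central vector to use.\<close>
  have "\<exists>u::'a. u \<noteq> 0"
  proof (rule ccontr)
    assume "\<not> (\<exists>u::'a. u \<noteq> 0)"
    then have "p = snd p *\<^sub>R (0, 1)" for p :: "'a \<times> real" by (simp add: prod_eq_iff)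
    then have "UNIV \<subseteq> span {(0::'a, 1::real)}" unfolding real_vector.span_singleton by blast
    then have "dim (UNIV :: ('a \<times> real) set) \<le> card {(0::'a, 1::real)}"
      by (rule real_vector.dim_le_card) simp
    then show False using dim3 by auto
  qed
  then obtain z where z: "z \<noteq> 0" "\<And>x. br x z = 0"
    using nilpotent_imp_central_vector[OF nil] by metis
  have z': "br z x = 0" for x using br_skew[of z x] z by simp
  have "s = 0"
  proof (rule ccontr)
    assume s: "s \<noteq> 0"
    have dz: "extend_metric g \<tau> (z, 0) (\<phi> (x, a)) = a * g v (D z) / 2" for x a
      using c.contact[of "(z, 0)" "(x, a)"] by (simp add: zeta z' g_simps)
    have "s * g v (D z) = 0"
      using dz[of v s] c.sasaki_imp_phi_xi[OF sas] by (simp add: zeta sd.g_simps)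
    then have "g v (D z) = 0" using s by simp
    have "\<phi> (z, 0) = 0"
    proof (rule sd.eq_by_metric)
      fix p :: "'a \<times> real"
      show "extend_metric g \<tau> (\<phi> (z, 0)) p = extend_metric g \<tau> 0 p"
        using dz[of "fst p" "snd p"] \<open>g v (D z) = 0\<close> by (simp add: c.phi_skew sd.g_simps)
    qed
    moreover have "\<phi> (\<phi> (z, 0)) + (z, 0) = \<eta> (z, 0) *\<^sub>R \<zeta>" using sq[of "(z, 0)"] by (simp add: zero_prod_def)
    ultimately obtain c where "(z, 0) = c *\<^sub>R \<zeta>" by (simp add: c.phi_simps)
    then show False using s z(1) by (simp add: zeta)
  qed
  moreover have "D v = 0"
  proof (rule eq_by_metric)
    fix w
    show "g (D v) w = g 0 w"
      using c.sasaki_imp_killing[OF sas, unfolded c.killing_def, rule_format, of "(0, 1)" "(w, 0)"]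
      by (simp add: zeta \<open>s = 0\<close> g_simps br_simps D_simps)
  qed
  ultimately show ?thesis using that zeta by simp
qed

lemma sasaki_iff_conditions:
  assumes nil: "nilpotent_lie_algebra br"
  shows "sasaki (semidirect br D) \<phi> \<zeta> \<eta> (extend_metric g \<tau>) \<longleftrightarrow>
    (\<exists>\<xi>. g \<xi> \<xi> = 1 \<and> sasaki_conditions br g D \<tau> \<xi> \<and>
      \<zeta> = (\<xi>, 0) \<and> \<eta> = (\<lambda>p. flat g \<xi> (fst p)) \<and> \<phi> = sasaki_phi br g D \<tau> \<xi>)" (is "?S \<longleftrightarrow> ?C")
proof -
  have flat: "flat (extend_metric g \<tau>) (\<xi>, 0) = (\<lambda>p. flat g \<xi> (fst p))" for \<xi>
    by (auto simp: flat_def extend_metric_def)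
  show ?thesis
  proof
    assume S: ?S
    obtain \<xi> where xi: "\<zeta> = (\<xi>, 0)" "D \<xi> = 0" by (rule sasaki_reeb_horizontal[OF nil S])
    have eta: "\<eta> = flat (extend_metric g \<tau>) (\<xi>, 0)" and unit: "g \<xi> \<xi> = 1"
      and contact: "\<And>p q. - extend_metric g \<tau> (\<xi>, 0) (semidirect br D p q) = 2 * extend_metric g \<tau> p (\<phi> q)"
      using S xi by (auto simp: sasaki_def almost_contact_metric_def ext_d_def fundamental_form_def flat_def)
    interpret r: semidirect_reeb br g D \<tau> \<xi> by unfold_locales (use unit xi in auto)
    have phi: "\<phi> = sasaki_phi br g D \<tau> \<xi>" by (rule r.contact_imp_sasaki_phi[OF contact])
    have "sasaki_conditions br g D \<tau> \<xi>"
      using S r.sasaki_phi_iff by (simp add: phi xi eta)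
    then show ?C using unit xi phi eta flat by auto
  next
    assume ?C
    then obtain \<xi> where xi: "g \<xi> \<xi> = 1" "sasaki_conditions br g D \<tau> \<xi>"
      "\<zeta> = (\<xi>, 0)" "\<eta> = (\<lambda>p. flat g \<xi> (fst p))" "\<phi> = sasaki_phi br g D \<tau> \<xi>" by blast
    interpret r: semidirect_reeb br g D \<tau> \<xi>
      by unfold_locales (use xi in \<open>auto simp: sasaki_conditions_def Let_def\<close>)
    show ?S using r.sasaki_phi_iff xi by (simp add: flat)
  qed
qed

end

theorem proposition3p3:
  fixes br :: "'a::real_vector \<Rightarrow> 'a \<Rightarrow> 'a"
    and g :: "'a \<Rightarrow> 'a \<Rightarrow> real"
    and D :: "'a \<Rightarrow> 'a"
    and \<tau> :: real
  assumes "nilpotent_lie_algebra br"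
    and "pseudo_metric g"
    and "derivation br D"
    and "\<tau> = 1 \<or> \<tau> = - 1"
  shows "((\<exists>\<phi> \<zeta> \<eta>. sasaki (semidirect br D) \<phi> \<zeta> \<eta> (extend_metric g \<tau>)) \<longleftrightarrow>
            (\<exists>\<xi>. g \<xi> \<xi> = 1 \<and> sasaki_conditions br g D \<tau> \<xi>)) \<and>
         (\<forall>\<phi> \<zeta> \<eta>. sasaki (semidirect br D) \<phi> \<zeta> \<eta> (extend_metric g \<tau>) \<longleftrightarrow>
            (\<exists>\<xi>. g \<xi> \<xi> = 1 \<and> sasaki_conditions br g D \<tau> \<xi> \<and>
                 \<zeta> = (\<xi>, 0) \<and> \<eta> = (\<lambda>p. flat g \<xi> (fst p)) \<and> \<phi> = sasaki_phi br g D \<tau> \<xi>))"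
proof -
  interpret semidirect_metric br g D \<tau>
    using assms by unfold_locales (simp_all add: nilpotent_lie_algebra_def)
  show ?thesis using sasaki_iff_conditions[OF assms(1)] by blast
qed

end
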